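(* Let $E(n,m)$ denote the Euler numbers of the second kind. For every integer $n>0$, $$\sum_{m=0}^{n}(-1)^m\sum_{i=0}^{n}\sum_{k=0}^{i}\binom{m+k}{m}\,E(m+k,\,n-i)\binom{m+k+i-1}{2m+2k-1}=0.$$
   Context: The Euler numbers of the second kind $E(n,m)$ (second-order Eulerian numbers, indexed so that the triangle begins with $E(1,1)=1$, OEIS A008517) are defined for integers $n\ge 0$ and $m\in\mathbb{Z}$ by $E(0,0)=1$, $E(0,m)=0$ for $m\ne 0$, and, for $n\ge 1$, $$E(n,m)=m\,E(n-1,m)+(2n-m)\,E(n-1,m-1).$$ In particular $E(1,1)=1$, $E(1,m)=0$ for $m\neq 1$, and for $n\ge1$, $E(n,m)=0$ unless $1\le m\le n$. The binomial coefficient $\binom{a}{b}$ is the usual one for integers $a,b\ge 0$ (zero if $b>a$), and $\binom{a}{b}=0$ whenever $b<0$. *)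

theory Defs
  imports Main
begin

(* Second-order Eulerian numbers, indexed as in OEIS A008517: row 1 is euler2 1 1 = 1. *)
fun euler2 :: "nat \<Rightarrow> int \<Rightarrow> int" where
  "euler2 0 m = (if m = 0 then 1 else 0)"
| "euler2 (Suc n) m = m * euler2 n m + (2 * int (Suc n) - m) * euler2 n (m - 1)"

(* The lower index may be negative, so truncated subtraction on nat is not an option.
   Binomials with negative upper and nonnegative lower index play no role here;
   they are set to 0. *)
definition ibinom :: "int \<Rightarrow> int \<Rightarrow> int" where
  "ibinom a b = (if 0 \<le> a \<and> 0 \<le> b then int (nat a choose nat b) else 0)"

end

theory Submission
  imports Defs
begin

text \<open>
  The Euler numbers enter only through their first index being \<open>m + k\<close>. Fix \<open>i\<close> and put
  \<open>p = m + k\<close>. Apart from the sign and the first binomial coefficient, the summand depends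
  on \<open>p\<close> alone, say it is \<open>g p\<close>, where \<open>g p\<close> contains the factor
  \<open>p + i - 1\<close> choose \<open>2p - 1\<close>. That factor vanishes for \<open>p = 0\<close>, the lower index being
  negative, and for \<open>p > i\<close>. As \<open>i \<le> n\<close>, the ranges of \<open>m\<close> and \<open>k\<close> contain all pairs with
  \<open>m + k \<le> i\<close>, so collecting the terms with \<open>m + k = p\<close> gives
  \<open>\<Sum>p. g p * (\<Sum>m\<le>p. (-1)^m * (p choose m))\<close>, whose inner sum is \<open>(1 - 1)^p = 0\<close> for \<open>p > 0\<close>.
  The contribution of each \<open>i\<close> is therefore zero.
\<close>

lemma alternating_binomial_diagonal_sum:
  fixes g :: "nat \<Rightarrow> 'a::comm_ring_1"
  assumes "g 0 = 0" and large: "\<And>p. p > i \<Longrightarrow> g p = 0" and "i \<le> n"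
  shows "(\<Sum>m = 0..n. \<Sum>k = 0..i. (-1) ^ m * of_nat ((m + k) choose m) * g (m + k)) = 0"
proof -
  let ?f = "\<lambda>m k. (-1) ^ m * of_nat ((m + k) choose m) * g (m + k)"
  have "(\<Sum>m = 0..n. \<Sum>k = 0..i. ?f m k) = (\<Sum>(m, k)\<in>{0..n} \<times> {0..i}. ?f m k)"
    by (simp add: sum.cartesian_product)
  also have "\<dots> = (\<Sum>(m, k)\<in>{(m, k). m + k \<le> i}. ?f m k)"
    using \<open>i \<le> n\<close> by (intro sum.mono_neutral_right) (auto, metis large mult_zero_right not_le)
  also have "\<dots> = (\<Sum>p\<le>i. \<Sum>m\<le>p. ?f m (p - m))"
    by (rule sum.triangle_reindex_eq)
  also have "\<dots> = (\<Sum>p\<le>i. (\<Sum>m\<le>p. (-1) ^ m * of_nat (p choose m)) * g p)"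
    by (simp add: sum_distrib_right)
  also have "\<dots> = 0"
  proof (rule sum.neutral, intro ballI)
    fix p
    show "(\<Sum>m\<le>p. (-1) ^ m * of_nat (p choose m)) * g p = 0"
      using \<open>g 0 = 0\<close> by (cases "p = 0") (simp_all add: choose_alternating_sum)
  qed
  finally show ?thesis .
qed

lemma ibinom_of_nat: "ibinom (int a) (int b) = int (a choose b)"
  by (simp add: ibinom_def)

lemma ibinom_eq_0:
  assumes "b < 0 \<or> a < b"
  shows "ibinom a b = 0"
  using assms by (auto simp: ibinom_def intro!: binomial_eq_0)

theorem mainTheorem4:
  fixes n :: nat
  assumes "n > 0"
  shows "(\<Sum>m = 0..n. (-1) ^ m * (\<Sum>i = 0..n. \<Sum>k = 0..i.
            ibinom (int m + int k) (int m) * euler2 (m + k) (int n - int i)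
              * ibinom (int m + int k + int i - 1) (2 * int m + 2 * int k - 1))) = 0"
proof -
  define g where "g i p = euler2 p (int n - int i) * ibinom (int p + int i - 1) (2 * int p - 1)"
    for i p
  have "(\<Sum>m = 0..n. (-1) ^ m * (\<Sum>i = 0..n. \<Sum>k = 0..i.
            ibinom (int m + int k) (int m) * euler2 (m + k) (int n - int i)
              * ibinom (int m + int k + int i - 1) (2 * int m + 2 * int k - 1)))
        = (\<Sum>m = 0..n. \<Sum>i = 0..n. \<Sum>k = 0..i. (-1) ^ m * of_nat ((m + k) choose m) * g i (m + k))"
    by (simp add: g_def sum_distrib_left algebra_simps flip: ibinom_of_nat)
  also have "\<dots> = (\<Sum>i = 0..n. \<Sum>m = 0..n. \<Sum>k = 0..i. (-1) ^ m * of_nat ((m + k) choose m) * g i (m + k))"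
    by (rule sum.swap)
  also have "\<dots> = 0"
  proof (rule sum.neutral, intro ballI)
    fix i
    assume "i \<in> {0..n}"
    then show "(\<Sum>m = 0..n. \<Sum>k = 0..i. (-1) ^ m * of_nat ((m + k) choose m) * g i (m + k)) = 0"
      by (intro alternating_binomial_diagonal_sum) (auto simp: g_def ibinom_eq_0)
  qed
  finally show ?thesis .
qed

end
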